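(* Let $\{\omega_n\}_{n\ge 1}$ be a Jacobi sequence with $\omega_n>0$ for all $n\ge 1$, and let $\Gamma_{\{\omega_n\}}=(\Gamma(\mathbb{C}),a,a^{\ast})$ be the corresponding interacting Fock space with orthonormal basis $\{\Phi_n\}_{n\ge 0}$ and states $\varphi_N(\cdot)=\langle \Phi_N,(\cdot)\Phi_N\rangle$. Assume $$\lim_{n\to\infty}\frac{\omega_{n+1}}{\omega_n}=1.$$ For each $N\ge 1$ let $\mu_N$ be a probability distribution on $\mathbb{R}$ such that $$\frac{a+a^{\ast}}{\sqrt{2\omega_N}}\sim_{\varphi_N}\mu_N,$$ that is, $\varphi_N\Big(\big(\tfrac{a+a^{\ast}}{\sqrt{2\omega_N}}\big)^m\Big)=\int_{\mathbb{R}}x^m\,\mu_N(dx)$ for all $m\in\mathbb{N}$. Then, as $N\to\infty$, $\mu_N$ converges weakly to the arcsine law $$\mu_{As}(dx)=\frac{1}{\pi}\frac{dx}{\sqrt{2-x^2}}\qquad(-\sqrt{2}<x<\sqrt{2}).$$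
   Context: Interacting Fock space: given a sequence $\{\omega_n\}_{n\ge 1}$ of positive reals (a Jacobi sequence of infinite type), $\Gamma(\mathbb{C})=\bigoplus_{n=0}^{\infty}\mathbb{C}\Phi_n$ is the Hilbert space with orthonormal basis $\{\Phi_n\}_{n\ge 0}$, and $a,a^{\ast}$ are the linear operators, acting on the linear span of $\{\Phi_n\}_{n\ge 0}$, given by $$a\Phi_0=0,\qquad a\Phi_n=\sqrt{\omega_n}\,\Phi_{n-1}\ (n\ge 1),\qquad a^{\ast}\Phi_n=\sqrt{\omega_{n+1}}\,\Phi_{n+1}\ (n\ge 0).$$ $\mathcal{A}$ denotes the $\ast$-algebra generated by $a$, and $\varphi_N:\mathcal{A}\to\mathbb{C}$ is the state $\varphi_N(X)=\langle\Phi_N,X\Phi_N\rangle$. For $X\in\mathcal{A}$, a state $\varphi$ on $\mathcal{A}$ and a probability distribution $\mu$ on $\mathbb{R}$, the notation $X\sim_{\varphi}\mu$ means that $\varphi(X^m)=\int_{\mathbb{R}}x^m\,\mu(dx)$ for all $m\in\mathbb{N}$ (in particular $\mu$ has finite moments of all orders). *)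

theory Defs
  imports "HOL-Probability.Probability"
begin

text \<open>
  The Hilbert space with orthonormal basis \<open>\<Phi>\<^sub>0, \<Phi>\<^sub>1, \<dots>\<close> is realised as the square-summable
  complex sequences, a vector being the sequence of its coordinates. The inner product is
  conjugate-linear in the first argument.
\<close>

definition fock_space :: "(nat \<Rightarrow> complex) set" where
  "fock_space = {x. summable (\<lambda>n. (cmod (x n))\<^sup>2)}"

definition fock_inner :: "(nat \<Rightarrow> complex) \<Rightarrow> (nat \<Rightarrow> complex) \<Rightarrow> complex" where
  "fock_inner x y = (\<Sum>n. cnj (x n) * y n)"

definition fock_basis :: "nat \<Rightarrow> nat \<Rightarrow> complex" where
  "fock_basis n = (\<lambda>k. if k = n then 1 else 0)"

text \<open>The linear span of the basis, which is the domain of the operators below.\<close>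

definition fock_span :: "(nat \<Rightarrow> complex) set" where
  "fock_span = {x. finite {n. x n \<noteq> 0}}"

text \<open>
  The coordinate formulas make sense for arbitrary sequences; only their restrictions to
  \<open>fock_span\<close> matter. There they are the linear extensions of the rules for basis vectors,
  see \<open>annihilation_basis\<close> and \<open>creation_basis\<close>. The Jacobi sequence is indexed from 1, and
  the value \<open>\<omega> 0\<close> is irrelevant.
\<close>

definition annihilation :: "(nat \<Rightarrow> real) \<Rightarrow> (nat \<Rightarrow> complex) \<Rightarrow> nat \<Rightarrow> complex" where
  "annihilation \<omega> x = (\<lambda>n. complex_of_real (sqrt (\<omega> (n + 1))) * x (n + 1))"

definition creation :: "(nat \<Rightarrow> real) \<Rightarrow> (nat \<Rightarrow> complex) \<Rightarrow> nat \<Rightarrow> complex" where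
  "creation \<omega> x = (\<lambda>n. if n = 0 then 0 else complex_of_real (sqrt (\<omega> n)) * x (n - 1))"

text \<open>The operator \<open>(a + a\<^sup>*) / c\<close>.\<close>

definition scaled_field :: "(nat \<Rightarrow> real) \<Rightarrow> real \<Rightarrow> (nat \<Rightarrow> complex) \<Rightarrow> nat \<Rightarrow> complex" where
  "scaled_field \<omega> c x = (\<lambda>n. (annihilation \<omega> x n + creation \<omega> x n) / complex_of_real c)"

definition fock_state :: "nat \<Rightarrow> ((nat \<Rightarrow> complex) \<Rightarrow> nat \<Rightarrow> complex) \<Rightarrow> complex" where
  "fock_state N X = fock_inner (fock_basis N) (X (fock_basis N))"

definition has_moments_of ::
  "(((nat \<Rightarrow> complex) \<Rightarrow> nat \<Rightarrow> complex) \<Rightarrow> complex) \<Rightarrow>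
   ((nat \<Rightarrow> complex) \<Rightarrow> nat \<Rightarrow> complex) \<Rightarrow> real measure \<Rightarrow> bool" where
  "has_moments_of \<phi> X \<mu> \<longleftrightarrow>
     (\<forall>m::nat. integrable \<mu> (\<lambda>x. x ^ m) \<and> \<phi> (X ^^ m) = complex_of_real (\<integral>x. x ^ m \<partial>\<mu>))"

definition arcsine_law :: "real measure" where
  "arcsine_law = density lborel
     (\<lambda>x. ennreal (indicator {- sqrt 2<..<sqrt 2} x * (1 / pi) * (1 / sqrt (2 - x\<^sup>2))))"

lemma fock_span_subset_fock_space: "fock_span \<subseteq> fock_space"
  unfolding fock_span_def fock_space_def
  by (auto intro: summable_finite[where N = "{n. x n \<noteq> 0}" for x :: "nat \<Rightarrow> complex"])

lemma fock_basis_in_span: "fock_basis n \<in> fock_span"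
  by (simp add: fock_span_def fock_basis_def)

lemma fock_inner_basis: "fock_inner (fock_basis m) x = x m"
proof -
  have "fock_inner (fock_basis m) x = (\<Sum>n\<in>{m}. cnj (fock_basis m n) * x n)"
    unfolding fock_inner_def by (rule suminf_finite) (auto simp: fock_basis_def)
  then show ?thesis by (simp add: fock_basis_def)
qed

lemma fock_basis_orthonormal:
  "fock_inner (fock_basis m) (fock_basis n) = (if m = n then 1 else 0)"
  by (simp add: fock_inner_basis) (simp add: fock_basis_def)

lemma annihilation_basis:
  "annihilation \<omega> (fock_basis 0) = (\<lambda>k. 0)"
  "n \<ge> 1 \<Longrightarrow> annihilation \<omega> (fock_basis n) =
     (\<lambda>k. complex_of_real (sqrt (\<omega> n)) * fock_basis (n - 1) k)"
  by (auto simp: annihilation_def fock_basis_def fun_eq_iff)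

lemma creation_basis:
  "creation \<omega> (fock_basis n) =
     (\<lambda>k. complex_of_real (sqrt (\<omega> (n + 1))) * fock_basis (n + 1) k)"
  by (auto simp: creation_def fock_basis_def fun_eq_iff)

lemma annihilation_linear:
  "annihilation \<omega> (\<lambda>k. c * x k + d * y k) =
     (\<lambda>k. c * annihilation \<omega> x k + d * annihilation \<omega> y k)"
  by (simp add: annihilation_def algebra_simps)

lemma creation_linear:
  "creation \<omega> (\<lambda>k. c * x k + d * y k) =
     (\<lambda>k. c * creation \<omega> x k + d * creation \<omega> y k)"
  by (auto simp: creation_def algebra_simps)

lemma annihilation_in_span:
  assumes "x \<in> fock_span" shows "annihilation \<omega> x \<in> fock_span"
proof -
  have "finite (Suc -` {n. x n \<noteq> 0})"
    using assms by (intro finite_vimageI) (auto simp: fock_span_def)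
  moreover have "{n. annihilation \<omega> x n \<noteq> 0} \<subseteq> Suc -` {n. x n \<noteq> 0}"
    by (auto simp: annihilation_def)
  ultimately show ?thesis unfolding fock_span_def by (auto intro: finite_subset)
qed

lemma creation_in_span:
  assumes "x \<in> fock_span" shows "creation \<omega> x \<in> fock_span"
proof -
  have "finite (Suc ` {n. x n \<noteq> 0})"
    using assms by (auto simp: fock_span_def)
  moreover have "{n. creation \<omega> x n \<noteq> 0} \<subseteq> Suc ` {n. x n \<noteq> 0}"
    by (auto simp: creation_def image_iff split: if_splits intro!: exI[of _ "_ - 1"])
  ultimately show ?thesis unfolding fock_span_def by (auto intro: finite_subset)
qed

lemma creation_adjoint:
  assumes "x \<in> fock_span" and "y \<in> fock_span"
  shows "fock_inner (creation \<omega> x) y = fock_inner x (annihilation \<omega> y)"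
proof -
  have "finite {n. cnj (creation \<omega> x n) * y n \<noteq> 0}"
    by (rule finite_subset[of _ "{n. y n \<noteq> 0}"]) (use assms(2) in \<open>auto simp: fock_span_def\<close>)
  then have "summable (\<lambda>n. cnj (creation \<omega> x n) * y n)"
    by (rule summable_finite) auto
  from suminf_split_head[OF this] show ?thesis
    by (simp add: fock_inner_def creation_def annihilation_def mult_ac)
qed

end

theory Submission
  imports Defs
begin

text \<open>
  The coefficient of \<open>\<Phi>\<^bsub>N+j\<^esub>\<close> in \<open>((a + a\<^sup>*) / sqrt (2 \<omega>\<^sub>N))\<^sup>k \<Phi>\<^sub>N\<close> converges, as \<open>N \<rightarrow> \<infinity>\<close>, to the
  solution of the recursion \<open>c\<^bsub>k+1\<^esub>(j) = (c\<^sub>k(j+1) + c\<^sub>k(j-1)) / sqrt 2\<close> on the two-sided lattice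
  started from the unit mass at \<open>j = 0\<close>, because all the ratios \<open>\<omega>\<^bsub>N+j\<^esub> / \<omega>\<^sub>N\<close> tend to 1. Writing
  \<open>x = sqrt 2 cos \<theta>\<close>, the numbers \<open>\<integral> x\<^sup>k cos (j \<theta>) d\<mu>\<^sub>A\<^sub>s\<close> solve the same recursion, so that the
  moments of \<open>\<mu>\<^sub>N\<close> converge to those of the arcsine law (the case \<open>j = 0\<close>). As this law has bounded
  support, Taylor expansion of the characteristic functions and Levy's theorem give weak
  convergence.
\<close>

section \<open>Convergence of moments to those of a law with bounded support\<close>

text \<open>The Taylor remainder of a characteristic function at even order \<open>2 * m\<close> is
  controlled by the moment of that order. For \<open>L\<close> this moment is at most
  \<open>r ^ (2 * m)\<close>, which the factorial beats; for \<open>M n\<close> it converges to that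
  of \<open>L\<close>. Hence \<open>m\<close> is fixed first, then \<open>n\<close> grows.\<close>

lemma weak_conv_m_if_moments_conv:
  assumes M: "\<And>n. real_distribution (M n)" and L: "real_distribution L"
    and int: "\<And>n k. integrable (M n) (\<lambda>x. x ^ k)"
    and bdd: "AE x in L. \<bar>x\<bar> \<le> r"
    and conv: "\<And>k. (\<lambda>n. \<integral>x. x ^ k \<partial>M n) \<longlonglongrightarrow> (\<integral>x. x ^ k \<partial>L)"
  shows "weak_conv_m M L"
proof (rule levy_continuity[OF M L])
  fix t :: real
  interpret Mn: real_distribution "M n" for n by (rule M)
  interpret L: real_distribution L by (rule L)
  \<comment> \<open>Taylor polynomials of degree \<open>m\<close> of the two characteristic
    functions, evaluated at \<open>t\<close>.\<close>
  define P where "P m n = (\<Sum>k\<le>m. ((\<i> * t) ^ k / fact k) * of_real (\<integral>x. x ^ k \<partial>M n))" for m n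
  define Q where "Q m = (\<Sum>k\<le>m. ((\<i> * t) ^ k / fact k) * of_real (\<integral>x. x ^ k \<partial>L))" for m
  have powr: "AE x in L. \<bar>x ^ k\<bar> \<le> r ^ k" for k
    using bdd by eventually_elim (simp add: power_abs power_mono)
  have intL: "integrable L (\<lambda>x. x ^ k)" for k
    by (rule L.integrable_const_bound[of _ "r ^ k"]) (use powr in auto)
  have momL: "(\<integral>x. x ^ k \<partial>L) \<le> r ^ k" for k
  proof -
    have "(\<integral>x. x ^ k \<partial>L) \<le> (\<integral>x. r ^ k \<partial>L)"
      by (rule integral_mono_AE) (use intL powr[of k] in \<open>auto elim!: eventually_mono\<close>)
    then show ?thesis using L.prob_space by simp
  qed
  \<comment> \<open>Remainder bound for \<open>L\<close>: twice a term of the exponential series at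
    \<open>\<bar>t\<bar> * r\<close>. Even order makes absolute moments ordinary ones.\<close>
  define e where [abs_def]: "e m = 2 * (\<bar>t\<bar> * r) ^ (2 * m) / fact (2 * m)" for m
  have "(\<lambda>m. 2 * (inverse (fact m) * (\<bar>t\<bar> * r) ^ m)) \<longlonglongrightarrow> 2 * 0"
    using summable_LIMSEQ_zero[OF summable_exp[of "\<bar>t\<bar> * r"]] by (intro tendsto_mult) auto
  from LIMSEQ_subseq_LIMSEQ[OF this, of "\<lambda>m. 2 * m"] have e: "e \<longlonglongrightarrow> 0"
    by (simp add: e_def strict_mono_def o_def field_simps)
  show "(\<lambda>n. char (M n) t) \<longlonglongrightarrow> char L t"
    unfolding tendsto_iff
  proof (intro allI impI)
    fix \<epsilon> :: real assume "\<epsilon> > 0"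
    then have "eventually (\<lambda>m. e m < \<epsilon> / 2) sequentially"
      using e by (intro order_tendstoD(2)) auto
    then obtain m where m: "e m < \<epsilon> / 2" by (auto simp: eventually_sequentially)
    \<comment> \<open>The three errors on the way from \<open>char (M n) t\<close> through
      \<open>P\<close> and \<open>Q\<close> to \<open>char L t\<close>; the limit of the sum is at
      most \<open>2 * e m\<close>.\<close>
    define E where "E n = 2 * \<bar>t\<bar> ^ (2 * m) / fact (2 * m) * (\<integral>x. x ^ (2 * m) \<partial>M n)
      + cmod (P (2 * m) n - Q (2 * m)) + e m" for n
    have "(\<lambda>n. P (2 * m) n - Q (2 * m)) \<longlonglongrightarrow> Q (2 * m) - Q (2 * m)"
      unfolding P_def Q_def by (intro tendsto_intros conv)
    then have lim: "E \<longlonglongrightarrow> 2 * \<bar>t\<bar> ^ (2 * m) / fact (2 * m) * (\<integral>x. x ^ (2 * m) \<partial>L) + cmod 0 + e m"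
      unfolding E_def by (intro tendsto_intros conv) simp_all
    have le: "2 * \<bar>t\<bar> ^ (2 * m) / fact (2 * m) * (\<integral>x. x ^ (2 * m) \<partial>L) \<le> e m"
      using mult_left_mono[OF momL[of "2 * m"], of "2 * \<bar>t\<bar> ^ (2 * m) / fact (2 * m)"]
      by (simp add: e_def power_mult_distrib)
    have "eventually (\<lambda>n. E n < \<epsilon>) sequentially"
    proof (rule order_tendstoD(2)[OF lim])
      show "2 * \<bar>t\<bar> ^ (2 * m) / fact (2 * m) * (\<integral>x. x ^ (2 * m) \<partial>L) + cmod 0 + e m < \<epsilon>"
        using le m by (simp only: norm_zero)
    qed
    then show "eventually (\<lambda>n. dist (char (M n) t) (char L t) < \<epsilon>) sequentially"
    proof eventually_elim
      case (elim n)
      have 1: "cmod (char (M n) t - P (2 * m) n)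
          \<le> 2 * \<bar>t\<bar> ^ (2 * m) / fact (2 * m) * (\<integral>x. x ^ (2 * m) \<partial>M n)"
        using Mn.char_approx1[of "2 * m" n t] int by (simp add: P_def power_even_abs)
      have "cmod (char L t - Q (2 * m))
          \<le> 2 * \<bar>t\<bar> ^ (2 * m) / fact (2 * m) * (\<integral>x. x ^ (2 * m) \<partial>L)"
        using L.char_approx1[of "2 * m" t] intL by (simp add: Q_def power_even_abs)
      then have 2: "cmod (char L t - Q (2 * m)) \<le> e m"
        using le by linarith
      have "dist (char (M n) t) (char L t) \<le> E n"
        using 1 2 norm_triangle_ineq[of "char (M n) t - P (2 * m) n" "P (2 * m) n - Q (2 * m)"]
          norm_triangle_ineq4[of "char (M n) t - Q (2 * m)" "char L t - Q (2 * m)"]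
        by (simp add: dist_norm E_def)
      with elim show ?case by simp
    qed
  qed
qed

section \<open>The arcsine law\<close>

text \<open>Clipping makes the angle continuous on the whole line.\<close>

definition arcsine_angle :: "real \<Rightarrow> real" where
  "arcsine_angle x = arccos (max (- 1) (min 1 (x / sqrt 2)))"

lemma continuous_on_arcsine_angle [continuous_intros]:
  "continuous_on A f \<Longrightarrow> continuous_on A (\<lambda>x. arcsine_angle (f x))"
  unfolding arcsine_angle_def by (intro continuous_intros) auto

lemma borel_measurable_arcsine_angle [measurable]: "arcsine_angle \<in> borel_measurable borel"
  by (intro borel_measurable_continuous_onI continuous_intros)

lemma cos_arcsine_angle:
  assumes "x \<in> {- sqrt 2<..<sqrt 2}"
  shows "sqrt 2 * cos (arcsine_angle x) = x"
proof -
  have "- 1 \<le> x / sqrt 2" "x / sqrt 2 \<le> 1"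
    using assms by (simp_all add: pos_le_divide_eq pos_divide_le_eq)
  then show ?thesis by (simp add: arcsine_angle_def)
qed

text \<open>Clipping is inactive on the open interval, so this is the chain rule for
  \<open>arccos\<close>. It makes \<open>- arcsine_angle\<close> an antiderivative of the
  unnormalised density.\<close>

lemma DERIV_arcsine_angle:
  assumes x: "x \<in> {- sqrt 2<..<sqrt 2}"
  shows "(arcsine_angle has_real_derivative - (1 / sqrt (2 - x\<^sup>2))) (at x)"
proof (rule has_field_derivative_transform_within_open[where S = "{- sqrt 2<..<sqrt 2}"])
  have b: "- 1 < x / sqrt 2" "x / sqrt 2 < 1"
    using x by (simp_all add: pos_less_divide_eq pos_divide_less_eq)
  have "sqrt (1 - (x / sqrt 2)\<^sup>2) * sqrt 2 = sqrt (2 - x\<^sup>2)"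
    by (subst real_sqrt_mult[symmetric]) (simp add: power_divide algebra_simps)
  then have eq: "inverse (- sqrt (1 - (x / sqrt 2)\<^sup>2)) * (1 / sqrt 2) = - (1 / sqrt (2 - x\<^sup>2))"
    by (metis divide_inverse inverse_minus_eq inverse_mult_distrib mult.left_neutral
        mult_minus_left)
  have "((\<lambda>x. arccos (x / sqrt 2)) has_real_derivative
      inverse (- sqrt (1 - (x / sqrt 2)\<^sup>2)) * (1 / sqrt 2)) (at x)"
    by (rule DERIV_chain2[OF DERIV_arccos[OF b] DERIV_cdivide[OF DERIV_ident]])
  then show "((\<lambda>x. arccos (x / sqrt 2)) has_real_derivative - (1 / sqrt (2 - x\<^sup>2))) (at x)"
    by (simp only: eq)
  fix y assume "y \<in> {- sqrt 2<..<sqrt 2}"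
  then have "- 1 \<le> y / sqrt 2" "y / sqrt 2 \<le> 1"
    by (simp_all add: pos_le_divide_eq pos_divide_le_eq)
  then show "arccos (y / sqrt 2) = arcsine_angle y" by (simp add: arcsine_angle_def)
qed (use x in auto)

lemma arcsine_angle_ends: "arcsine_angle (- sqrt 2) = pi" "arcsine_angle (sqrt 2) = 0"
  by (simp_all add: arcsine_angle_def)

lemma square_less_two:
  assumes "x \<in> {- sqrt 2<..<sqrt 2}" shows "x\<^sup>2 < 2"
  using assms real_sqrt_less_iff[of "x\<^sup>2" 2] by (simp add: abs_less_iff)

text \<open>Supplies the boundary limits for the fundamental theorem on an open interval, where the
  integrand may blow up at the ends while its antiderivative stays continuous.\<close>

lemma interval_tendsto_continuous:
  fixes F :: "real \<Rightarrow> real"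
  assumes "continuous_on UNIV F"
  shows "((F \<circ> real_of_ereal) \<longlongrightarrow> F a) (at_right (ereal a))"
    and "((F \<circ> real_of_ereal) \<longlongrightarrow> F a) (at_left (ereal a))"
proof -
  have "(F \<longlongrightarrow> F a) (at a)"
    using assms by (simp add: continuous_on_eq_continuous_at isCont_def)
  then have "(F \<longlongrightarrow> F a) (at_right a)" "(F \<longlongrightarrow> F a) (at_left a)"
    by (auto intro: filterlim_at_split[THEN iffD1, THEN conjunct2]
        filterlim_at_split[THEN iffD1, THEN conjunct1])
  then show "((F \<circ> real_of_ereal) \<longlongrightarrow> F a) (at_right (ereal a))"
    and "((F \<circ> real_of_ereal) \<longlongrightarrow> F a) (at_left (ereal a))"
    by (simp_all add: ereal_tendsto_simps)
qed

lemma isCont_arcsine_density: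
  "x \<in> {- sqrt 2<..<sqrt 2} \<Longrightarrow> isCont (\<lambda>x. 1 / sqrt (2 - x\<^sup>2)) x"
  using square_less_two[of x] by (intro continuous_intros) auto

lemma einterval_sqrt2: "einterval (ereal (- sqrt 2)) (ereal (sqrt 2)) = {- sqrt 2<..<sqrt 2}"
  by (auto simp: einterval_def)

text \<open>The integrand is nonnegative with antiderivative \<open>- arcsine_angle\<close>, which
  rises from \<open>- pi\<close> to 0; this gives integrability despite the endpoint
  singularities.\<close>

lemma arcsine_density_integral:
  "set_integrable lborel {- sqrt 2<..<sqrt 2} (\<lambda>x. 1 / sqrt (2 - x\<^sup>2))"
  "(LBINT x=ereal (- sqrt 2)..ereal (sqrt 2). 1 / sqrt (2 - x\<^sup>2)) = pi"
proof -
  have c: "continuous_on UNIV (\<lambda>x. - arcsine_angle x)" by (intro continuous_intros)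
  have d: "((\<lambda>x. - arcsine_angle x) has_real_derivative 1 / sqrt (2 - x\<^sup>2)) (at x)"
    if "x \<in> {- sqrt 2<..<sqrt 2}" for x
    using DERIV_minus[OF DERIV_arcsine_angle[OF that]] by simp
  have nn: "0 \<le> 1 / sqrt (2 - x\<^sup>2)" if "x \<in> {- sqrt 2<..<sqrt 2}" for x
    using square_less_two[OF that] by simp
  note FTC = interval_integral_FTC_nonneg[OF _ _ _ _
      interval_tendsto_continuous(1)[OF c] interval_tendsto_continuous(2)[OF c],
      of "- sqrt 2" "sqrt 2" "\<lambda>x. 1 / sqrt (2 - x\<^sup>2)"]
  show "set_integrable lborel {- sqrt 2<..<sqrt 2} (\<lambda>x. 1 / sqrt (2 - x\<^sup>2))"
    unfolding einterval_sqrt2[symmetric]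
    by (rule FTC(1)) (use d isCont_arcsine_density nn in auto)
  have "(LBINT x=ereal (- sqrt 2)..ereal (sqrt 2). 1 / sqrt (2 - x\<^sup>2))
      = - arcsine_angle (sqrt 2) - - arcsine_angle (- sqrt 2)"
    by (rule FTC(2)) (use d isCont_arcsine_density nn in auto)
  then show "(LBINT x=ereal (- sqrt 2)..ereal (sqrt 2). 1 / sqrt (2 - x\<^sup>2)) = pi"
    by (simp add: arcsine_angle_ends)
qed

lemma arcsine_density_nonneg:
  "0 \<le> indicator {- sqrt 2<..<sqrt 2} x * (1 / pi) * (1 / sqrt (2 - x\<^sup>2))"
  using square_less_two[of x] by (auto simp: indicator_def)

lemma integral_arcsine_law:
  fixes f :: "real \<Rightarrow> real"
  assumes [measurable]: "f \<in> borel_measurable borel"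
  shows "(\<integral>x. f x \<partial>arcsine_law)
    = (LBINT x=ereal (- sqrt 2)..ereal (sqrt 2). f x / sqrt (2 - x\<^sup>2)) / pi"
proof -
  have "(\<integral>x. f x \<partial>arcsine_law)
    = (\<integral>x. indicator {- sqrt 2<..<sqrt 2} x * (1 / pi) * (1 / sqrt (2 - x\<^sup>2)) * f x \<partial>lborel)"
    unfolding arcsine_law_def
    by (subst integral_density) (auto intro!: AE_I2 arcsine_density_nonneg[simplified])
  also have "\<dots> = (\<integral>x. (1 / pi) * (indicator {- sqrt 2<..<sqrt 2} x * (f x / sqrt (2 - x\<^sup>2))) \<partial>lborel)"
    by (intro Bochner_Integration.integral_cong) auto
  also have "\<dots> = (1 / pi) * (\<integral>x. indicator {- sqrt 2<..<sqrt 2} x * (f x / sqrt (2 - x\<^sup>2)) \<partial>lborel)"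
    by (rule integral_mult_right_zero)
  finally show ?thesis
    by (simp add: interval_lebesgue_integral_le_eq set_lebesgue_integral_def einterval_sqrt2)
qed

lemma real_distribution_arcsine_law: "real_distribution arcsine_law"
proof -
  let ?f = "\<lambda>x. indicator {- sqrt 2<..<sqrt 2} x * (1 / pi) * (1 / sqrt (2 - x\<^sup>2))"
  have i: "integrable lborel (\<lambda>x. (1 / pi) * (indicator {- sqrt 2<..<sqrt 2} x * (1 / sqrt (2 - x\<^sup>2))))"
    using arcsine_density_integral(1) unfolding set_integrable_def
    by (intro integrable_mult_right) simp
  have "(\<integral>x. ?f x \<partial>lborel)
      = (\<integral>x. (1 / pi) * (indicator {- sqrt 2<..<sqrt 2} x * (1 / sqrt (2 - x\<^sup>2))) \<partial>lborel)"
    by (simp add: mult_ac)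
  also have "\<dots> = (1 / pi) * (\<integral>x. indicator {- sqrt 2<..<sqrt 2} x * (1 / sqrt (2 - x\<^sup>2)) \<partial>lborel)"
    by (rule integral_mult_right_zero)
  also have "\<dots> = 1"
    using arcsine_density_integral(2)
    by (simp add: interval_lebesgue_integral_le_eq set_lebesgue_integral_def einterval_sqrt2)
  finally have "(\<integral>x. ?f x \<partial>lborel) = 1" .
  moreover have "integrable lborel ?f"
    using i by (simp add: mult_ac)
  ultimately have "(\<integral>\<^sup>+x. ennreal (?f x) \<partial>lborel) = 1"
    by (subst nn_integral_eq_integral) (auto intro!: AE_I2 arcsine_density_nonneg[simplified])
  then have "prob_space arcsine_law"
    by (intro prob_spaceI) (simp add: arcsine_law_def emeasure_density)
  then show ?thesis
    by (simp add: real_distribution_def real_distribution_axioms_def arcsine_law_def)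
qed

lemma AE_arcsine_law: "AE x in arcsine_law. x \<in> {- sqrt 2<..<sqrt 2}"
  unfolding arcsine_law_def by (subst AE_density) (auto simp: indicator_def)

lemma AE_arcsine_law_abs_le: "AE x in arcsine_law. \<bar>x\<bar> \<le> sqrt 2"
  using AE_arcsine_law by eventually_elim auto

text \<open>Mixed moments with the Chebyshev polynomials, as \<open>cos (j \<theta>)\<close> is the
  one of degree \<open>\<bar>j\<bar>\<close> at \<open>cos \<theta>\<close>. Integer
  \<open>j\<close> lets the recursion run without a boundary case.\<close>

definition arcsine_coeff :: "nat \<Rightarrow> int \<Rightarrow> real" where
  "arcsine_coeff k j = (\<integral>x. x ^ k * cos (of_int j * arcsine_angle x) \<partial>arcsine_law)"

text \<open>Orthogonality of the Chebyshev polynomials to constants: in the angle the law is uniform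
  on \<open>[0, pi]\<close>, and \<open>sin (j \<theta>)\<close> vanishes at both ends.\<close>

lemma arcsine_coeff_zero: "arcsine_coeff 0 j = (if j = 0 then 1 else 0)"
proof (cases "j = 0")
  case True
  interpret real_distribution arcsine_law by (rule real_distribution_arcsine_law)
  show ?thesis using True prob_space by (simp add: arcsine_coeff_def)
next
  case False
  define F where "F x = - sin (of_int j * arcsine_angle x) / of_int j" for x
  have c: "continuous_on UNIV F" unfolding F_def using False by (intro continuous_intros) auto
  have d: "(F has_real_derivative cos (of_int j * arcsine_angle x) / sqrt (2 - x\<^sup>2)) (at x)"
    if "x \<in> {- sqrt 2<..<sqrt 2}" for x
    unfolding F_def using False
    by (auto intro!: derivative_eq_intros DERIV_arcsine_angle[OF that])
  have cont: "isCont (\<lambda>x. cos (of_int j * arcsine_angle x) / sqrt (2 - x\<^sup>2)) x"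
    if "x \<in> {- sqrt 2<..<sqrt 2}" for x
    using square_less_two[OF that]
    by (intro continuous_intros DERIV_isCont[OF DERIV_arcsine_angle[OF that]]) auto
  \<comment> \<open>The cosine changes sign, so integrability comes from domination by the
    density.\<close>
  have "set_integrable lborel {- sqrt 2<..<sqrt 2}
      (\<lambda>x. cos (of_int j * arcsine_angle x) / sqrt (2 - x\<^sup>2))"
    unfolding set_integrable_def
  proof (rule Bochner_Integration.integrable_bound[OF
        arcsine_density_integral(1)[unfolded set_integrable_def]])
    show "AE x in lborel. norm (indicator {- sqrt 2<..<sqrt 2} x *\<^sub>R
        (cos (of_int j * arcsine_angle x) / sqrt (2 - x\<^sup>2)))
      \<le> norm (indicator {- sqrt 2<..<sqrt 2} x *\<^sub>R (1 / sqrt (2 - x\<^sup>2)))"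
      by (auto simp: abs_mult indicator_def intro!: AE_I2 divide_right_mono)
  qed measurable
  then have "(LBINT x=ereal (- sqrt 2)..ereal (sqrt 2).
      cos (of_int j * arcsine_angle x) / sqrt (2 - x\<^sup>2)) = F (sqrt 2) - F (- sqrt 2)"
    unfolding einterval_sqrt2[symmetric]
    by (intro interval_integral_FTC_integrable)
      (use d cont interval_tendsto_continuous[OF c] in
        \<open>auto simp: has_real_derivative_iff_has_vector_derivative\<close>)
  also have "\<dots> = 0"
    by (simp add: F_def arcsine_angle_ends sin_int_times_real sin_times_pi_eq_0)
  finally show ?thesis
    using False by (simp add: arcsine_coeff_def integral_arcsine_law)
qed

text \<open>One factor \<open>x = sqrt 2 * cos \<theta>\<close> is absorbed by the product formula
  for \<open>2 cos \<theta> cos (j \<theta>)\<close>.\<close>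

lemma arcsine_coeff_Suc:
  "arcsine_coeff (Suc k) j = (arcsine_coeff k (j + 1) + arcsine_coeff k (j - 1)) / sqrt 2"
proof -
  interpret real_distribution arcsine_law by (rule real_distribution_arcsine_law)
  have int: "integrable arcsine_law (\<lambda>x. x ^ k * cos (of_int i * arcsine_angle x))" for i
  proof (rule integrable_const_bound[of _ "sqrt 2 ^ k"])
    show "AE x in arcsine_law. norm (x ^ k * cos (of_int i * arcsine_angle x)) \<le> sqrt 2 ^ k"
      using AE_arcsine_law_abs_le
    proof eventually_elim
      case (elim x)
      then have "\<bar>x\<bar> ^ k * \<bar>cos (of_int i * arcsine_angle x)\<bar> \<le> sqrt 2 ^ k * 1"
        by (intro mult_mono power_mono) auto
      then show ?case by (simp add: abs_mult power_abs)
    qed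
  qed measurable
  have "arcsine_coeff (Suc k) j = (\<integral>x. (x ^ k * cos (of_int (j + 1) * arcsine_angle x)
      + x ^ k * cos (of_int (j - 1) * arcsine_angle x)) / sqrt 2 \<partial>arcsine_law)"
    unfolding arcsine_coeff_def
  \<comment> \<open>The substitution \<open>x = sqrt 2 * cos \<theta>\<close> fails where the angle
    is clipped, so the identity is claimed only almost everywhere.\<close>
  proof (rule integral_cong_AE)
    show "AE x in arcsine_law. x ^ Suc k * cos (of_int j * arcsine_angle x)
        = (x ^ k * cos (of_int (j + 1) * arcsine_angle x)
           + x ^ k * cos (of_int (j - 1) * arcsine_angle x)) / sqrt 2"
      using AE_arcsine_law
    proof eventually_elim
      case (elim x)
      define \<theta> where "\<theta> = arcsine_angle x"
      have x: "x = sqrt 2 * cos \<theta>"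
        using cos_arcsine_angle[OF elim] by (simp add: \<theta>_def)
      have "x ^ k * cos (of_int (j + 1) * \<theta>) + x ^ k * cos (of_int (j - 1) * \<theta>)
          = x ^ k * (2 * cos \<theta> * cos (of_int j * \<theta>))"
        by (simp add: algebra_simps cos_add cos_diff)
      also have "2 * cos \<theta> = sqrt 2 * x"
        by (simp add: x flip: mult.assoc)
      finally show ?case by (simp add: \<theta>_def)
    qed
  qed measurable
  also have "\<dots> = (arcsine_coeff k (j + 1) + arcsine_coeff k (j - 1)) / sqrt 2"
    unfolding arcsine_coeff_def integral_divide_zero
    by (simp only: Bochner_Integration.integral_add[OF int int])
  finally show ?thesis .
qed

section \<open>Powers of the field operator on basis vectors\<close>

text \<open>For \<open>j \<ge> 0\<close> the quotient is a product of \<open>j\<close> consecutive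
  ratios, each tending to 1; a negative shift is the reciprocal after reindexing.\<close>

lemma tendsto_shifted_ratio:
  fixes \<omega> :: "nat \<Rightarrow> real"
  assumes pos: "\<And>n. n \<ge> 1 \<Longrightarrow> \<omega> n > 0"
    and lim: "(\<lambda>n. \<omega> (n + 1) / \<omega> n) \<longlonglongrightarrow> 1"
  shows "(\<lambda>N. \<omega> (nat (int N + j)) / \<omega> N) \<longlonglongrightarrow> 1"
proof -
  have up: "(\<lambda>N. \<omega> (N + m) / \<omega> N) \<longlonglongrightarrow> 1" for m
  proof (induction m)
    case 0
    have "eventually (\<lambda>N. \<omega> (N + 0) / \<omega> N = 1) sequentially"
      using pos by (intro eventually_sequentiallyI[of 1]) (auto simp: less_imp_neq[symmetric])
    then show ?case by (rule tendsto_eventually)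
  next
    case (Suc m)
    have "(\<lambda>N. \<omega> (N + m + 1) / \<omega> (N + m) * (\<omega> (N + m) / \<omega> N)) \<longlonglongrightarrow> 1 * 1"
      by (intro tendsto_mult LIMSEQ_ignore_initial_segment[OF lim, of m] Suc)
    moreover have "eventually (\<lambda>N. \<omega> (N + m + 1) / \<omega> (N + m) * (\<omega> (N + m) / \<omega> N)
        = \<omega> (N + Suc m) / \<omega> N) sequentially"
      using pos by (intro eventually_sequentiallyI[of 1]) (auto simp: less_imp_neq[symmetric])
    ultimately show ?case by (auto intro: Lim_transform_eventually)
  qed
  show ?thesis
  proof (cases "j \<ge> 0")
    case True
    then have "nat (int N + j) = N + nat j" for N by simp
    then show ?thesis using up by simp
  next
    case False
    define m where "m = nat (- j)"
    \<comment> \<open>Starting at index \<open>N + m\<close> keeps \<open>nat\<close> from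
      truncating; \<open>LIMSEQ_offset\<close> then removes the shift.\<close>
    have "(\<lambda>N. inverse (\<omega> (N + m) / \<omega> N)) \<longlonglongrightarrow> inverse 1"
      by (intro tendsto_inverse up) simp
    then have "(\<lambda>N. \<omega> N / \<omega> (N + m)) \<longlonglongrightarrow> 1" by simp
    moreover have "nat (int (N + m) + j) = N" for N
      using False by (simp add: m_def)
    ultimately have "(\<lambda>N. \<omega> (nat (int (N + m) + j)) / \<omega> (N + m)) \<longlonglongrightarrow> 1" by simp
    then show ?thesis by (rule LIMSEQ_offset)
  qed
qed

text \<open>Each step couples the coordinates \<open>j - 1\<close> and \<open>j + 1\<close>, so the
  induction on \<open>k\<close> treats all \<open>j\<close> at once.\<close>

lemma tendsto_scaled_field_power:
  fixes \<omega> :: "nat \<Rightarrow> real"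
  assumes pos: "\<And>n. n \<ge> 1 \<Longrightarrow> \<omega> n > 0"
    and lim: "(\<lambda>n. \<omega> (n + 1) / \<omega> n) \<longlonglongrightarrow> 1"
  shows "(\<lambda>N. (scaled_field \<omega> (sqrt (2 * \<omega> N)) ^^ k) (fock_basis N) (nat (int N + j)))
    \<longlonglongrightarrow> complex_of_real (arcsine_coeff k j)"
proof (induction k arbitrary: j)
  case 0
  have "eventually (\<lambda>N. fock_basis N (nat (int N + j)) = complex_of_real (arcsine_coeff 0 j))
      sequentially"
    by (intro eventually_sequentiallyI[of "nat \<bar>j\<bar>"]) (auto simp: fock_basis_def arcsine_coeff_zero)
  then show ?case by (simp add: tendsto_eventually)
next
  case (Suc k)
  define y where "y N i = (scaled_field \<omega> (sqrt (2 * \<omega> N)) ^^ k) (fock_basis N) (nat (int N + i))"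
    for N i
  \<comment> \<open>The normalised weights. Coordinate \<open>N + j\<close> receives weight
    \<open>q N (j + 1)\<close> from above by annihilation and \<open>q N j\<close> from below by
    creation.\<close>
  define q where "q N i = sqrt (\<omega> (nat (int N + i)) / \<omega> N)" for N i
  have q: "(\<lambda>N. q N i) \<longlonglongrightarrow> 1" for i
    using tendsto_real_sqrt[OF tendsto_shifted_ratio[OF pos lim, of i]] by (simp add: q_def)
  have y: "(\<lambda>N. y N i) \<longlonglongrightarrow> complex_of_real (arcsine_coeff k i)" for i
    unfolding y_def by (rule Suc)
  have "(\<lambda>N. (of_real (q N (j + 1)) * y N (j + 1) + of_real (q N j) * y N (j - 1)) / of_real (sqrt 2))
      \<longlonglongrightarrow> (of_real 1 * of_real (arcsine_coeff k (j + 1)) + of_real 1 * of_real (arcsine_coeff k (j - 1)))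
         / complex_of_real (sqrt 2)"
    by (intro tendsto_intros q y) simp
  then have "(\<lambda>N. (of_real (q N (j + 1)) * y N (j + 1) + of_real (q N j) * y N (j - 1)) / of_real (sqrt 2))
      \<longlonglongrightarrow> complex_of_real (arcsine_coeff (Suc k) j)"
    by (simp add: arcsine_coeff_Suc)
  moreover have "eventually (\<lambda>N. (of_real (q N (j + 1)) * y N (j + 1) + of_real (q N j) * y N (j - 1))
        / complex_of_real (sqrt 2)
      = (scaled_field \<omega> (sqrt (2 * \<omega> N)) ^^ Suc k) (fock_basis N) (nat (int N + j))) sequentially"
  \<comment> \<open>This bound gives \<open>N + j \<ge> 1\<close>: creation is in its nonzero branch
    and the index \<open>N + j - 1\<close> is not truncated.\<close>
  proof (intro eventually_sequentiallyI[of "nat \<bar>j\<bar> + 1"])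
    fix N assume N: "N \<ge> nat \<bar>j\<bar> + 1"
    have "nat (int N + j) + 1 = nat (int N + (j + 1))" "nat (int N + j) - 1 = nat (int N + (j - 1))"
      "nat (int N + j) \<noteq> 0"
      using N by linarith+
    then show "(of_real (q N (j + 1)) * y N (j + 1) + of_real (q N j) * y N (j - 1))
        / complex_of_real (sqrt 2)
      = (scaled_field \<omega> (sqrt (2 * \<omega> N)) ^^ Suc k) (fock_basis N) (nat (int N + j))"
      unfolding q_def y_def
      by (simp add: scaled_field_def annihilation_def creation_def real_sqrt_mult real_sqrt_divide
          add_divide_distrib mult_ac)
  qed
  ultimately show ?case by (rule Lim_transform_eventually)
qed

theorem theorem3p1:
  fixes \<omega> :: "nat \<Rightarrow> real" and \<mu> :: "nat \<Rightarrow> real measure"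
  assumes "\<And>n. n \<ge> 1 \<Longrightarrow> \<omega> n > 0"
    and "(\<lambda>n. \<omega> (n + 1) / \<omega> n) \<longlonglongrightarrow> 1"
    and "\<And>N. N \<ge> 1 \<Longrightarrow> real_distribution (\<mu> N)"
    and "\<And>N. N \<ge> 1 \<Longrightarrow>
           has_moments_of (fock_state N) (scaled_field \<omega> (sqrt (2 * \<omega> N))) (\<mu> N)"
  shows "weak_conv_m \<mu> arcsine_law"
proof -
  \<comment> \<open>The assumptions say nothing about \<open>\<mu> 0\<close>, so the sequence is
    shifted by one; the shift does not affect the limit.\<close>
  have "weak_conv_m (\<lambda>n. \<mu> (Suc n)) arcsine_law"
  proof (rule weak_conv_m_if_moments_conv[OF _ real_distribution_arcsine_law _ AE_arcsine_law_abs_le])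
    fix n k
    show "real_distribution (\<mu> (Suc n))" by (simp add: assms(3))
    show "integrable (\<mu> (Suc n)) (\<lambda>x. x ^ k)"
      using assms(4)[of "Suc n"] by (simp add: has_moments_of_def)
  next
    fix k
    \<comment> \<open>Pairing with \<open>fock_basis N\<close> reads off coordinate
      \<open>N\<close>, which is offset \<open>j = 0\<close> in the coefficient limit.\<close>
    have mom: "complex_of_real (\<integral>x. x ^ k \<partial>\<mu> (Suc n))
        = (scaled_field \<omega> (sqrt (2 * \<omega> (Suc n))) ^^ k) (fock_basis (Suc n)) (Suc n)" for n
      using assms(4)[of "Suc n"] by (simp add: has_moments_of_def fock_state_def fock_inner_basis)
    have "(\<lambda>N. (scaled_field \<omega> (sqrt (2 * \<omega> N)) ^^ k) (fock_basis N) N)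
        \<longlonglongrightarrow> complex_of_real (arcsine_coeff k 0)"
      using tendsto_scaled_field_power[OF assms(1,2), of k 0] by simp
    from LIMSEQ_Suc[OF this]
    have "(\<lambda>n. complex_of_real (\<integral>x. x ^ k \<partial>\<mu> (Suc n)))
        \<longlonglongrightarrow> complex_of_real (\<integral>x. x ^ k \<partial>arcsine_law)"
      by (simp add: mom arcsine_coeff_def)
    then show "(\<lambda>n. \<integral>x. x ^ k \<partial>\<mu> (Suc n)) \<longlonglongrightarrow> (\<integral>x. x ^ k \<partial>arcsine_law)"
      by (simp add: tendsto_of_real_iff)
  qed
  then show ?thesis
    unfolding weak_conv_m_def weak_conv_def
    by (subst (asm) filterlim_sequentially_Suc)
qed

end
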